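(* Let $\mu,\kappa$ be integers with $2\leq\kappa\leq\mu-2$, and consider the gradient field $W_{\mu,\kappa}$ on $X_{\mu,\kappa}=\operatorname{DConf}(\Delta^{\mu-1,\mu-\kappa-1},2)$. Let $(A,B)$ be a cell of $X_{\mu,\kappa}$, with $A=\{a_1<\cdots<a_r\}$, $B=\{b_1<\cdots<b_s\}$ and $r>1$. (1) Assume $\langle b_s+1,\mu\rangle\subseteq A$ and $s=1$. If $b_1-1\in A$, then $(A\setminus\{b_1-1\},B)\nearrow(A,B)$ is a directed edge in $W_{\mu,\kappa}$. (2) Assume $\langle b_s+1,\mu\rangle\not\subseteq A$ (in particular $b_s<\mu$) and $s=\mu-\kappa$. (2.a) If $a_r=\mu$, then $(A\setminus\{\mu\},B)\nearrow(A,B)$ is a directed edge in $W_{\mu,\kappa}$. (2.b) If $a_r<\mu$ and the three conditions (b.1) $\langle b_s+1,\mu-1\rangle\subseteq A$, (b.2) $\langle1,b_s-1\rangle\not\subseteq B$, (b.3) $\overline{a}:=\max\left(\langle1,b_s-1\rangle-B\right)\in A$ hold, then $(A\setminus\{\overline{a}\},B)\nearrow(A,B)$ is a directed edge in $W_{\mu,\kappa}$. Furthermore, the three types of directed edges described in (1), (2.a) and (2.b) account for all directed edges in $W_{\mu,\kappa}$ that arise by insertion of a vertex in the first coordinate of a cell of $X_{\mu,\kappa}$ (i.e. edges of the form $(A',B')\nearrow(A'\cup\{u\},B')$).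
   Context: For integers $p,q$, $\langle p,q\rangle=\{p,p+1,\ldots,q\}$, empty if $p>q$. $\Delta^{\mu-1,\mu-\kappa-1}$ is the $(\mu-\kappa-1)$-skeleton of the simplex with vertex set $\{1,2,\ldots,\mu\}$. $X=X_{\mu,\kappa}=\operatorname{DConf}(\Delta^{\mu-1,\mu-\kappa-1},2)$ is the subcomplex of the product cell complex of two copies of this skeleton consisting of products of two simplices with disjoint vertex sets. Its cells are the ordered pairs $(A,B)$ of disjoint nonempty subsets of $\{1,\ldots,\mu\}$, each of cardinality at most $\mu-\kappa$; the cell $(A,B)$ has dimension $|A|+|B|-2$, and faces are given by coordinatewise inclusion. For a cell $\alpha=(A,B)$ and $u\notin A\cup B$, put $\alpha+_1u=(A\cup\{u\},B)$ and $\alpha+_2u=(A,B\cup\{u\})$, whenever the result is a cell of $X$. Order on cells: simplices (vertex sets written as increasing lists) are ordered by dimension first and lexicographically within the same dimension; cells $(A,B)$ are ordered lexicographically over the two coordinates. Construction of $W=W_{\mu,\kappa}$: initialize $W:=\varnothing$ and, for each $p$, let $A^p$ be the set of all $p$-dimensional cells of $X$. For $p=\dim X-1,\ldots,1,0$ (in that order), provided $A^p$ and $A^{p+1}$ are currently nonempty, do: for $r=2,1$ (in that order); for $u=\mu,\mu-1,\ldots,1$ (in that order); for $\alpha$ running through the current $A^p$ in increasing order: if $\alpha+_ru$ is defined and currently $(\alpha,\alpha+_ru)\in A^p\times A^{p+1}$, add the directed edge $\alpha\nearrow\alpha+_ru$ to $W$, and remove $\alpha$ from $A^p$ and $\alpha+_ru$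 from $A^{p+1}$. The final $W$ is $W_{\mu,\kappa}$. *)

theory Defs
  imports Main "HOL-Library.List_Lenlexorder" "HOL-Library.Product_Lexorder"
begin

text \<open>Simplices are identified with their (nonempty) vertex sets.\<close>

type_synonym simplex = "nat set"
type_synonym cell = "simplex \<times> simplex"

text \<open>\<open>simplex_skeleton m d\<close> is the \<open>d\<close>-skeleton of the simplex with vertex set \<open>{1..m}\<close>.\<close>

definition simplex_skeleton :: "nat \<Rightarrow> nat \<Rightarrow> simplex set" where
  "simplex_skeleton m d = {\<sigma>. \<sigma> \<subseteq> {1..m} \<and> \<sigma> \<noteq> {} \<and> card \<sigma> \<le> d + 1}"

definition DConf2 :: "simplex set \<Rightarrow> cell set" where
  "DConf2 K = {(A, B). A \<in> K \<and> B \<in> K \<and> A \<inter> B = {}}"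

definition X :: "nat \<Rightarrow> nat \<Rightarrow> cell set" where
  "X \<mu> \<kappa> = DConf2 (simplex_skeleton \<mu> (\<mu> - \<kappa> - 1))"

definition cell_dim :: "cell \<Rightarrow> nat" where
  "cell_dim \<alpha> = card (fst \<alpha>) + card (snd \<alpha>) - 2"

definition dim_X :: "nat \<Rightarrow> nat \<Rightarrow> nat" where
  "dim_X \<mu> \<kappa> = Max (cell_dim ` X \<mu> \<kappa>)"

text \<open>
  Lists of naturals carry the order of \<open>List_Lenlexorder\<close> (first by length, then
  lexicographically), and pairs the lexicographic order of \<open>Product_Lexorder\<close>. Comparing cells
  through the following key is therefore exactly the order on cells: simplices by dimension and
  then lexicographically, cells lexicographically over the two coordinates.
\<close>

definition cell_key :: "cell \<Rightarrow> nat list \<times> nat list" where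
  "cell_key \<alpha> = (sorted_list_of_set (fst \<alpha>), sorted_list_of_set (snd \<alpha>))"

definition cells_increasing :: "cell set \<Rightarrow> cell list" where
  "cells_increasing S = sorted_key_list_of_set cell_key S"

text \<open>\<open>add_vertex r u \<alpha>\<close> is \<open>\<alpha> +\<^sub>r u\<close>; only the coordinates \<open>r = 1\<close> and \<open>r = 2\<close> are used.\<close>

definition add_vertex :: "nat \<Rightarrow> nat \<Rightarrow> cell \<Rightarrow> cell" where
  "add_vertex r u \<alpha> =
     (if r = 1 then (insert u (fst \<alpha>), snd \<alpha>) else (fst \<alpha>, insert u (snd \<alpha>)))"

definition add_vertex_defined :: "nat \<Rightarrow> nat \<Rightarrow> nat \<Rightarrow> nat \<Rightarrow> cell \<Rightarrow> bool" where
  "add_vertex_defined \<mu> \<kappa> r u \<alpha> \<longleftrightarrow>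
     u \<notin> fst \<alpha> \<union> snd \<alpha> \<and> add_vertex r u \<alpha> \<in> X \<mu> \<kappa>"

text \<open>
  A state of the construction consists of the directed edges collected so far, where
  \<open>(\<alpha>, \<beta>)\<close> stands for \<open>\<alpha> \<nearrow> \<beta>\<close>, and of the current sets \<open>A\<^sup>p\<close> of still available cells.
\<close>

type_synonym state = "(cell \<times> cell) set \<times> (nat \<Rightarrow> cell set)"

definition process_cell ::
    "nat \<Rightarrow> nat \<Rightarrow> nat \<Rightarrow> nat \<Rightarrow> nat \<Rightarrow> cell \<Rightarrow> state \<Rightarrow> state" where
  "process_cell \<mu> \<kappa> p r u \<alpha> st =
     (let W = fst st; S = snd st; \<beta> = add_vertex r u \<alpha> in
      if add_vertex_defined \<mu> \<kappa> r u \<alpha> \<and> \<alpha> \<in> S p \<and> \<beta> \<in> S (p + 1)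
      then (insert (\<alpha>, \<beta>) W, S(p := S p - {\<alpha>}, p + 1 := S (p + 1) - {\<beta>}))
      else st)"

text \<open>
  The cells to run through may be listed once before the innermost loop: the only cell
  of \<open>A\<^sup>p\<close> that is removed while \<open>\<alpha>\<close> is treated is \<open>\<alpha>\<close> itself.
\<close>

definition process_vertex ::
    "nat \<Rightarrow> nat \<Rightarrow> nat \<Rightarrow> nat \<Rightarrow> nat \<Rightarrow> state \<Rightarrow> state" where
  "process_vertex \<mu> \<kappa> p r u st =
     fold (process_cell \<mu> \<kappa> p r u) (cells_increasing (snd st p)) st"

definition process_coordinate :: "nat \<Rightarrow> nat \<Rightarrow> nat \<Rightarrow> nat \<Rightarrow> state \<Rightarrow> state" where
  "process_coordinate \<mu> \<kappa> p r st = fold (process_vertex \<mu> \<kappa> p r) (rev [1..<\<mu> + 1]) st"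

definition process_dim :: "nat \<Rightarrow> nat \<Rightarrow> nat \<Rightarrow> state \<Rightarrow> state" where
  "process_dim \<mu> \<kappa> p st =
     (if snd st p \<noteq> {} \<and> snd st (p + 1) \<noteq> {}
      then fold (process_coordinate \<mu> \<kappa> p) [2, 1] st
      else st)"

definition initial_state :: "nat \<Rightarrow> nat \<Rightarrow> state" where
  "initial_state \<mu> \<kappa> = ({}, \<lambda>p. {\<alpha> \<in> X \<mu> \<kappa>. cell_dim \<alpha> = p})"

definition W :: "nat \<Rightarrow> nat \<Rightarrow> (cell \<times> cell) set" where
  "W \<mu> \<kappa> = fst (fold (process_dim \<mu> \<kappa>) (rev [0..<dim_X \<mu> \<kappa>]) (initial_state \<mu> \<kappa>))"

end

theory Submission
  imports Defs
begin

text \<open>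
  The construction is greedy: at step \<open>(p, r, u)\<close> it adds exactly the pairs \<open>(\<alpha>, \<alpha> +\<^sub>r u)\<close> not
  meeting an earlier edge. So a set of candidate pairs equals \<open>W\<close> as soon as its pairs are disjoint and
  every other candidate meets one of its pairs that has an earlier step. Such a set can
  be written down. With \<open>M\<close> the largest vertex outside \<open>A\<close>, the second coordinate contributes
  \<open>(A, B) \<nearrow> (A, B \<union> {M})\<close> whenever \<open>M \<notin> B\<close> and \<open>B\<close> is not of maximal size. The cells missed by
  this are \<open>(A, {M})\<close> and those with \<open>B\<close> of maximal size and \<open>M \<notin> B\<close>; where possible, the former are matched by
  inserting \<open>M - 1\<close> into \<open>A\<close>, the latter by inserting \<open>\<mu>\<close> if some vertex strictly between \<open>Max B\<close>
  and \<open>\<mu>\<close> is missing from \<open>A\<close>, and otherwise the largest vertex below \<open>Max B\<close> that is not in \<open>B\<close>.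
  All blocking edges needed lie in the same dimension \<open>p\<close>.
\<close>

section \<open>Cells\<close>

lemma mem_X_iff:
  assumes "\<kappa> < \<mu>"
  shows "(A, B) \<in> X \<mu> \<kappa> \<longleftrightarrow> A \<subseteq> {1..\<mu>} \<and> B \<subseteq> {1..\<mu>} \<and> A \<noteq> {} \<and> B \<noteq> {} \<and>
    card A \<le> \<mu> - \<kappa> \<and> card B \<le> \<mu> - \<kappa> \<and> A \<inter> B = {}"
  using assms by (auto simp: X_def DConf2_def simplex_skeleton_def)

lemma X_subset_Pow: "X \<mu> \<kappa> \<subseteq> Pow {1..\<mu>} \<times> Pow {1..\<mu>}"
  by (auto simp: X_def DConf2_def simplex_skeleton_def)

lemma finite_simplices:
  assumes "(A, B) \<in> X \<mu> \<kappa>"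
  shows "finite A" "finite B"
  using assms X_subset_Pow[of \<mu> \<kappa>] by (auto intro: finite_subset[OF _ finite_atLeastAtMost])

lemma finite_X: "finite (X \<mu> \<kappa>)"
  by (rule finite_subset[OF X_subset_Pow]) simp

text \<open>A finite set is recovered from its sorted list, and the simplices of \<open>X\<close>
  are finite.\<close>

lemma inj_on_cell_key: "inj_on cell_key (X \<mu> \<kappa>)"
proof (rule inj_onI)
  fix \<alpha> \<beta> assume "\<alpha> \<in> X \<mu> \<kappa>" "\<beta> \<in> X \<mu> \<kappa>" and eq: "cell_key \<alpha> = cell_key \<beta>"
  then have "finite (fst \<alpha>)" "finite (snd \<alpha>)" "finite (fst \<beta>)" "finite (snd \<beta>)"
    using finite_simplices[of "fst \<alpha>" "snd \<alpha>"] finite_simplices[of "fst \<beta>" "snd \<beta>"] by auto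
  with eq show "\<alpha> = \<beta>"
    by (auto simp: cell_key_def prod_eq_iff dest: sorted_list_of_set_inject)
qed

text \<open>Insertions by key commute when distinct cells have distinct keys, so the fold behind
  \<open>sorted_key_list_of_set\<close> is studied on \<open>X\<close>, where the key is
  injective.\<close>

lemma set_cells_increasing:
  assumes "S \<subseteq> X \<mu> \<kappa>"
  shows "set (cells_increasing S) = S"
proof -
  interpret folding_on "X \<mu> \<kappa>" "insort_key cell_key" "[]"
  proof
    fix \<alpha> \<beta> assume "\<alpha> \<in> X \<mu> \<kappa>" "\<beta> \<in> X \<mu> \<kappa>"
    then have "\<alpha> = \<beta> \<or> cell_key \<alpha> \<noteq> cell_key \<beta>"
      using inj_on_cell_key by (auto dest: inj_onD)
    then show "insort_key cell_key \<beta> \<circ> insort_key cell_key \<alpha> =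
        insort_key cell_key \<alpha> \<circ> insort_key cell_key \<beta>"
      by (auto simp: fun_eq_iff intro: insort_key_left_comm)
  qed
  from finite_subset[OF assms finite_X] assms show ?thesis
    unfolding cells_increasing_def sorted_key_list_of_set_def
    by (induction S rule: finite_induct) (simp_all add: set_insort_key)
qed

lemma cell_dim_add_vertex:
  assumes "\<alpha> \<in> X \<mu> \<kappa>" and "add_vertex_defined \<mu> \<kappa> r u \<alpha>"
  shows "cell_dim (add_vertex r u \<alpha>) = Suc (cell_dim \<alpha>)"
proof -
  obtain A B where \<alpha>: "\<alpha> = (A, B)" by (cases \<alpha>)
  have "finite A" "finite B"
    using finite_simplices assms(1) unfolding \<alpha> by auto
  moreover have "A \<noteq> {}" "B \<noteq> {}"
    using assms(1) unfolding \<alpha> by (auto simp: X_def DConf2_def simplex_skeleton_def)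
  \<comment> \<open>Both cardinalities are positive, so the truncated subtraction of 2 in
    \<open>cell_dim\<close> loses nothing.\<close>
  ultimately have "card A > 0" "card B > 0" by (auto simp: card_gt_0_iff)
  with \<open>finite A\<close> \<open>finite B\<close> assms(2) show ?thesis
    by (auto simp: \<alpha> cell_dim_def add_vertex_def add_vertex_defined_def)
qed

text \<open>The vertex u is absent from both cells and can be removed again; hence two pairs of one
  step never share an upper cell.\<close>

lemma add_vertex_cancel:
  assumes "add_vertex_defined \<mu> \<kappa> r u \<alpha>" "add_vertex_defined \<mu> \<kappa> r u \<beta>"
    and "add_vertex r u \<alpha> = add_vertex r u \<beta>"
  shows "\<alpha> = \<beta>"
  using assms
  by (auto simp: add_vertex_def add_vertex_defined_def prod_eq_iff split: if_splits)

section \<open>The innermost loop\<close>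

definition available_pair ::
    "nat \<Rightarrow> nat \<Rightarrow> nat \<Rightarrow> nat \<Rightarrow> nat \<Rightarrow> (nat \<Rightarrow> cell set) \<Rightarrow> cell \<Rightarrow> bool" where
  "available_pair \<mu> \<kappa> p r u S \<alpha> \<longleftrightarrow>
     add_vertex_defined \<mu> \<kappa> r u \<alpha> \<and> \<alpha> \<in> S p \<and> add_vertex r u \<alpha> \<in> S (p + 1)"

text \<open>
  The available pairs for fixed \<open>p\<close>, \<open>r\<close>, \<open>u\<close> are pairwise disjoint, so all of them are added,
  whatever the order of the cells.
\<close>

lemma fold_process_cell:
  "fold (process_cell \<mu> \<kappa> p r u) xs (E, S) =
    (E \<union> (\<lambda>\<alpha>. (\<alpha>, add_vertex r u \<alpha>)) ` {\<alpha> \<in> set xs. available_pair \<mu> \<kappa> p r u S \<alpha>},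
     S(p := S p - {\<alpha> \<in> set xs. available_pair \<mu> \<kappa> p r u S \<alpha>},
       p + 1 := S (p + 1) - add_vertex r u ` {\<alpha> \<in> set xs. available_pair \<mu> \<kappa> p r u S \<alpha>}))"
proof (induction xs arbitrary: E S)
  case Nil
  then show ?case by simp
next
  case (Cons x xs)
  show ?case
  proof (cases "available_pair \<mu> \<kappa> p r u S x")
    case False
    then have "process_cell \<mu> \<kappa> p r u x (E, S) = (E, S)"
      by (auto simp: process_cell_def available_pair_def Let_def)
    moreover have "{\<alpha> \<in> set (x # xs). available_pair \<mu> \<kappa> p r u S \<alpha>} =
        {\<alpha> \<in> set xs. available_pair \<mu> \<kappa> p r u S \<alpha>}"
      using False by auto
    ultimately show ?thesis by (simp only: fold_simps Cons.IH)
  next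
    case True
    define S' where "S' = S(p := S p - {x}, p + 1 := S (p + 1) - {add_vertex r u x})"
    have step: "process_cell \<mu> \<kappa> p r u x (E, S) = (insert (x, add_vertex r u x) E, S')"
      using True by (auto simp: process_cell_def available_pair_def Let_def S'_def)
    \<comment> \<open>Taking out x and its upper cell leaves the other pairs intact: their upper
      cells differ by \<open>add_vertex_cancel\<close>, and lower and upper cells are kept in
      different sets.\<close>
    have avail: "available_pair \<mu> \<kappa> p r u S' \<alpha> \<longleftrightarrow> \<alpha> \<noteq> x \<and> available_pair \<mu> \<kappa> p r u S \<alpha>" for \<alpha>
      using True by (auto simp: available_pair_def S'_def dest: add_vertex_cancel)
    have ins: "{\<alpha> \<in> set (x # xs). available_pair \<mu> \<kappa> p r u S \<alpha>} =
        insert x {\<alpha> \<in> set xs. available_pair \<mu> \<kappa> p r u S' \<alpha>}"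
      using True unfolding avail by auto
    show ?thesis
      unfolding fold_simps step Cons.IH ins by (auto simp: S'_def fun_eq_iff)
  qed
qed

section \<open>The explicit matching\<close>

text \<open>
  For \<open>r = 2\<close> the inserted vertex \<open>u\<close> is the
  largest one outside \<open>A\<close>; the three alternatives in \<open>first_insertion\<close> correspond
  to (1), (2.a) and (2.b), with \<open>A\<close> being the first coordinate \<^emph>\<open>before\<close> the insertion.
\<close>

definition first_insertion :: "nat \<Rightarrow> nat \<Rightarrow> nat \<Rightarrow> simplex \<Rightarrow> simplex \<Rightarrow> bool" where
  "first_insertion \<mu> \<kappa> u A B \<longleftrightarrow>
     B = {u + 1} \<and> {u + 2..\<mu>} \<subseteq> A \<or>
     card B = \<mu> - \<kappa> \<and> u = \<mu> \<and> \<not> {Max B + 1..\<mu> - 1} \<subseteq> A \<or>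
     card B = \<mu> - \<kappa> \<and> \<mu> \<notin> A \<union> B \<and> {Max B + 1..\<mu> - 1} \<subseteq> A \<and> u < Max B \<and> {u + 1..Max B} \<subseteq> B"

definition matched :: "nat \<Rightarrow> nat \<Rightarrow> nat \<Rightarrow> nat \<Rightarrow> cell \<Rightarrow> bool" where
  "matched \<mu> \<kappa> r u \<alpha> \<longleftrightarrow> \<alpha> \<in> X \<mu> \<kappa> \<and> add_vertex_defined \<mu> \<kappa> r u \<alpha> \<and>
     (r = 2 \<and> {u + 1..\<mu>} \<subseteq> fst \<alpha> \<or> r = 1 \<and> first_insertion \<mu> \<kappa> u (fst \<alpha>) (snd \<alpha>))"

text \<open>For u outside both simplices, the enlarged cell lies in \<open>X\<close> iff u is a
  vertex and the enlarged coordinate has room for one more.\<close>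

lemma matched_2_iff:
  assumes "\<kappa> < \<mu>"
  shows "matched \<mu> \<kappa> 2 u (A, B) \<longleftrightarrow> (A, B) \<in> X \<mu> \<kappa> \<and> 1 \<le> u \<and> u \<le> \<mu> \<and> u \<notin> A \<and> u \<notin> B \<and>
    card B < \<mu> - \<kappa> \<and> {u + 1..\<mu>} \<subseteq> A"
proof (cases "(A, B) \<in> X \<mu> \<kappa>")
  case True
  with assms finite_simplices[OF True] show ?thesis
    by (auto simp: matched_def add_vertex_defined_def add_vertex_def mem_X_iff)
qed (simp add: matched_def)

lemma matched_1_iff:
  assumes "\<kappa> < \<mu>"
  shows "matched \<mu> \<kappa> (Suc 0) u (A, B) \<longleftrightarrow> (A, B) \<in> X \<mu> \<kappa> \<and> 1 \<le> u \<and> u \<le> \<mu> \<and> u \<notin> A \<and> u \<notin> B \<and>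
    card A < \<mu> - \<kappa> \<and> first_insertion \<mu> \<kappa> u A B"
proof (cases "(A, B) \<in> X \<mu> \<kappa>")
  case True
  with assms finite_simplices[OF True] show ?thesis
    by (auto simp: matched_def add_vertex_defined_def add_vertex_def mem_X_iff)
qed (simp add: matched_def)

lemma matched_imp:
  assumes "matched \<mu> \<kappa> r u \<alpha>"
  shows "\<alpha> \<in> X \<mu> \<kappa>" "add_vertex_defined \<mu> \<kappa> r u \<alpha>" "r = 1 \<or> r = 2" "1 \<le> u" "u \<le> \<mu>"
    "add_vertex r u \<alpha> \<in> X \<mu> \<kappa>"
proof -
  show *: "\<alpha> \<in> X \<mu> \<kappa>" "add_vertex_defined \<mu> \<kappa> r u \<alpha>" "r = 1 \<or> r = 2"
    using assms by (auto simp: matched_def)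
  then show **: "add_vertex r u \<alpha> \<in> X \<mu> \<kappa>" by (simp add: add_vertex_defined_def)
  then have "u \<in> {1..\<mu>}"
    using X_subset_Pow[of \<mu> \<kappa>] by (auto simp: add_vertex_def split: if_splits)
  then show "1 \<le> u" "u \<le> \<mu>" by auto
qed

section \<open>States of the run, described by sets of steps\<close>

definition edges_where :: "nat \<Rightarrow> nat \<Rightarrow> (nat \<Rightarrow> nat \<Rightarrow> nat \<Rightarrow> bool) \<Rightarrow> (cell \<times> cell) set" where
  "edges_where \<mu> \<kappa> P =
     {(\<alpha>, add_vertex r u \<alpha>) | \<alpha> r u. matched \<mu> \<kappa> r u \<alpha> \<and> P (cell_dim \<alpha>) r u}"

definition untouched :: "nat \<Rightarrow> nat \<Rightarrow> (nat \<Rightarrow> nat \<Rightarrow> nat \<Rightarrow> bool) \<Rightarrow> cell \<Rightarrow> bool" where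
  "untouched \<mu> \<kappa> P \<gamma> \<longleftrightarrow> \<gamma> \<notin> fst ` edges_where \<mu> \<kappa> P \<union> snd ` edges_where \<mu> \<kappa> P"

text \<open>The state expected once exactly the steps (p, r, u) satisfying P have been carried
  out.\<close>

definition state_of :: "nat \<Rightarrow> nat \<Rightarrow> (nat \<Rightarrow> nat \<Rightarrow> nat \<Rightarrow> bool) \<Rightarrow> state" where
  "state_of \<mu> \<kappa> P =
     (edges_where \<mu> \<kappa> P, \<lambda>q. {\<alpha> \<in> X \<mu> \<kappa>. cell_dim \<alpha> = q \<and> untouched \<mu> \<kappa> P \<alpha>})"

text \<open>One step of the greedy run: the hypothesis says that the matching takes exactly the
  candidates with both cells still free, and the greedy rule takes the same ones.\<close>

lemma process_vertex_state_of:
  assumes local: "\<And>\<alpha>. \<alpha> \<in> X \<mu> \<kappa> \<Longrightarrow> cell_dim \<alpha> = p \<Longrightarrow> add_vertex_defined \<mu> \<kappa> r u \<alpha> \<Longrightarrow>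
      matched \<mu> \<kappa> r u \<alpha> \<longleftrightarrow> untouched \<mu> \<kappa> P \<alpha> \<and> untouched \<mu> \<kappa> P (add_vertex r u \<alpha>)"
  shows "process_vertex \<mu> \<kappa> p r u (state_of \<mu> \<kappa> P) =
    state_of \<mu> \<kappa> (\<lambda>p' r' u'. P p' r' u' \<or> p' = p \<and> r' = r \<and> u' = u)"
proof -
  define M where "M = {\<alpha>. matched \<mu> \<kappa> r u \<alpha> \<and> cell_dim \<alpha> = p}"
  define Q where "Q = (\<lambda>p' r' u'. P p' r' u' \<or> p' = p \<and> r' = r \<and> u' = u)"
  define S where "S = snd (state_of \<mu> \<kappa> P)"
  have Sq: "S q = {\<alpha> \<in> X \<mu> \<kappa>. cell_dim \<alpha> = q \<and> untouched \<mu> \<kappa> P \<alpha>}" for q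
    by (simp add: S_def state_of_def)
  have st: "state_of \<mu> \<kappa> P = (edges_where \<mu> \<kappa> P, S)"
    by (simp add: S_def state_of_def)
  have set: "set (cells_increasing (S p)) = S p"
    by (rule set_cells_increasing[of _ \<mu> \<kappa>]) (auto simp: Sq)
  have M: "{\<alpha> \<in> S p. available_pair \<mu> \<kappa> p r u S \<alpha>} = M"
  proof (intro set_eqI)
    fix \<alpha>
    show "\<alpha> \<in> {\<alpha> \<in> S p. available_pair \<mu> \<kappa> p r u S \<alpha>} \<longleftrightarrow> \<alpha> \<in> M"
    proof (cases "\<alpha> \<in> X \<mu> \<kappa> \<and> cell_dim \<alpha> = p \<and> add_vertex_defined \<mu> \<kappa> r u \<alpha>")
      case True
      moreover from True have "add_vertex r u \<alpha> \<in> X \<mu> \<kappa>" by (simp add: add_vertex_defined_def)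
      moreover from True have "cell_dim (add_vertex r u \<alpha>) = Suc p"
        using cell_dim_add_vertex by blast
      ultimately show ?thesis
        using local[of \<alpha>] by (auto simp: M_def Sq available_pair_def)
    next
      case False
      then show ?thesis
        by (auto simp: M_def Sq available_pair_def dest: matched_imp)
    qed
  qed
  have edges: "edges_where \<mu> \<kappa> Q = edges_where \<mu> \<kappa> P \<union> (\<lambda>\<alpha>. (\<alpha>, add_vertex r u \<alpha>)) ` M"
    by (auto simp: edges_where_def Q_def M_def)
  have unt: "untouched \<mu> \<kappa> Q \<gamma> \<longleftrightarrow> untouched \<mu> \<kappa> P \<gamma> \<and> \<gamma> \<notin> M \<and> \<gamma> \<notin> add_vertex r u ` M" for \<gamma>
    unfolding untouched_def edges by (auto simp: image_Un image_image)
  \<comment> \<open>Lower cells have dimension p and upper cells p + 1, so the removals affect just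
    these two sets.\<close>
  have dimM: "\<alpha> \<in> M \<Longrightarrow> cell_dim \<alpha> = p" for \<alpha> by (simp add: M_def)
  have dimM': "\<gamma> \<in> add_vertex r u ` M \<Longrightarrow> cell_dim \<gamma> = Suc p" for \<gamma>
    by (auto simp: M_def dest: matched_imp cell_dim_add_vertex)
  have "snd (state_of \<mu> \<kappa> Q) = S(p := S p - M, p + 1 := S (p + 1) - add_vertex r u ` M)"
    using dimM dimM' by (fastforce simp: state_of_def fun_eq_iff unt Sq)
  then show ?thesis
    unfolding process_vertex_def st snd_conv fold_process_cell set M Q_def[symmetric]
    by (simp add: state_of_def edges)
qed

section \<open>Disjointness and blocking\<close>

lemma Max_simplex:
  assumes "(A, B) \<in> X \<mu> \<kappa>"
  shows "Max B \<in> B" "x \<in> B \<Longrightarrow> x \<le> Max B" "Max B \<le> \<mu>"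
proof -
  have *: "finite B" "B \<noteq> {}" "B \<subseteq> {1..\<mu>}"
    using assms finite_simplices[OF assms] by (auto simp: X_def DConf2_def simplex_skeleton_def)
  then show "Max B \<in> B" by simp
  with * have "Max B \<in> {1..\<mu>}" by blast
  then show "Max B \<le> \<mu>" by auto
  show "x \<in> B \<Longrightarrow> x \<le> Max B" using * by simp
qed

text \<open>Both u and v are the largest number up to m outside S.\<close>

lemma gap_unique:
  fixes u v :: nat
  assumes "u \<notin> S" "{u + 1..m} \<subseteq> S" "u \<le> m" "v \<notin> S" "{v + 1..m} \<subseteq> S" "v \<le> m"
  shows "u = v"
proof (rule linorder_cases[of u v])
  assume "u < v"
  with assms have "v \<in> {u + 1..m}" by simp
  with assms show ?thesis by blast
next
  assume "v < u"
  with assms have "u \<in> {v + 1..m}" by simp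
  with assms show ?thesis by blast
qed

section \<open>Disjointness of the matched pairs\<close>

lemma first_insertion_cases:
  assumes "\<kappa> + 2 \<le> \<mu>" "first_insertion \<mu> \<kappa> u A B"
  obtains (single) "card B \<noteq> \<mu> - \<kappa>" "B = {u + 1}" "{u + 2..\<mu>} \<subseteq> A"
  | (last) "card B = \<mu> - \<kappa>" "u = \<mu>" "\<not> {Max B + 1..\<mu> - 1} \<subseteq> A"
  | (gap) "card B = \<mu> - \<kappa>" "\<mu> \<notin> A" "\<mu> \<notin> B" "{Max B + 1..\<mu> - 1} \<subseteq> A" "u < Max B"
    "{u + 1..Max B} \<subseteq> B"
proof -
  have "card B \<noteq> \<mu> - \<kappa>" if "B = {u + 1}"
    using that assms(1) by simp
  with assms(2) show ?thesis
    unfolding first_insertion_def using that by blast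
qed

text \<open>The last hypothesis covers pairs with a common lower cell and pairs with a common upper
  cell.\<close>

lemma first_insertion_unique:
  assumes "\<kappa> + 2 \<le> \<mu>" "Max B \<le> \<mu>"
    and u: "first_insertion \<mu> \<kappa> u A B" "u \<notin> B" and v: "first_insertion \<mu> \<kappa> v A' B" "v \<notin> B"
    and A: "A' = A \<or> insert u A = insert v A'"
  shows "u = v"
  using assms(1) u(1)
proof (cases rule: first_insertion_cases)
  case u: single
  from assms(1) v(1) show ?thesis
    by (cases rule: first_insertion_cases) (use u in auto)
next
  case u: last
  from assms(1) v(1) show ?thesis
  proof (cases rule: first_insertion_cases)
    case v: gap
    \<comment> \<open>Equal lower cells would make \<open>{Max B + 1..\<mu> - 1}\<close> both
      contained and not contained in A. So the upper cells agree and \<mu> = u lies in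
      \<open>insert v A'\<close>; as \<open>A'\<close> misses \<mu>, v = \<mu>.\<close>
    have "A' \<noteq> A" using u v by blast
    then have "\<mu> \<in> insert v A'" using A u by blast
    then show ?thesis using u v by blast
  qed (use u in auto)
next
  case ugap: gap
  from assms(1) v(1) show ?thesis
  proof (cases rule: first_insertion_cases)
    case v: last
    have "A' \<noteq> A" using ugap v by blast
    then have "\<mu> \<in> insert u A" using A v by blast
    then show ?thesis using ugap v by blast
  next
    case gap
    show ?thesis
      by (rule gap_unique[of u B "Max B" v]) (use ugap gap u v in simp_all)
  qed (use ugap in auto)
qed

text \<open>A singleton B, or the gap in a full B, determines the inserted vertex, which is now
  present. After inserting \<mu>, neither alternative for a full B can apply; after filling a gap,
  the block above \<open>Max B\<close> still lies in the first coordinate, so \<mu> is not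
  inserted.\<close>

lemma not_first_insertion_insert:
  assumes "\<kappa> + 2 \<le> \<mu>" "Max B \<le> \<mu>"
    and u: "first_insertion \<mu> \<kappa> u A B" "u \<notin> B" and v: "v \<notin> insert u A" "v \<notin> B"
  shows "\<not> first_insertion \<mu> \<kappa> v (insert u A) B"
proof
  assume F: "first_insertion \<mu> \<kappa> v (insert u A) B"
  from assms(1) u(1) show False
  proof (cases rule: first_insertion_cases)
    case u: single
    from assms(1) F show False
      by (cases rule: first_insertion_cases) (use u v in auto)
  next
    case u: last
    from assms(1) F show False
      by (cases rule: first_insertion_cases) (use u v in auto)
  next
    case ugap: gap
    from assms(1) F show False
    proof (cases rule: first_insertion_cases)
      case last
      then show False using ugap by blast
    next
      case gap
      have "u = v"
        by (rule gap_unique[of u B "Max B" v]) (use ugap gap u v in simp_all)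
      then show False using v by simp
    qed (use ugap in auto)
  qed
qed

text \<open>Either B is full, or the largest vertex outside \<open>A'\<close> is u + 1, which
  already lies in B. Allowing any \<open>A'\<close> above A covers both the lower and the upper cell
  of the first-coordinate edge.\<close>

lemma first_insertion_not_matched_2:
  assumes "\<kappa> + 2 \<le> \<mu>" "first_insertion \<mu> \<kappa> u A B"
    and "(A', B) \<in> X \<mu> \<kappa>" "A \<subseteq> A'"
  shows "\<not> matched \<mu> \<kappa> 2 v (A', B)"
proof
  assume "matched \<mu> \<kappa> 2 v (A', B)"
  then have v: "v \<le> \<mu>" "v \<notin> A'" "v \<notin> B" "card B < \<mu> - \<kappa>" "{v + 1..\<mu>} \<subseteq> A'"
    using assms(1) by (simp_all add: matched_2_iff)
  from assms(1,2) show False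
  proof (cases rule: first_insertion_cases)
    case single
    with assms have "u + 1 \<notin> A'" "u + 1 \<le> \<mu>" by (auto simp: mem_X_iff)
    moreover have "{u + 1 + 1..\<mu>} \<subseteq> A'" using single assms(4) by simp
    ultimately have "v = u + 1"
      using v by (intro gap_unique[of v A' \<mu> "u + 1"]) simp_all
    then show False using v single by simp
  qed (use v in simp_all)
qed

text \<open>A common upper cell makes v the largest vertex outside \<open>insert u A\<close> and a
  member of B. A singleton B would leave \<open>B'\<close> empty; for a full B some vertex above v
  is missing from \<open>insert u A\<close>: one strictly between \<open>Max B\<close> and \<mu>, or
  \<mu> itself.\<close>

lemma first_insertion_no_common_target:
  assumes "\<kappa> + 2 \<le> \<mu>" "first_insertion \<mu> \<kappa> u A B" "(A, B) \<in> X \<mu> \<kappa>"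
    and "matched \<mu> \<kappa> 2 v (insert u A, B')"
  shows "B \<noteq> insert v B'"
proof
  assume B: "B = insert v B'"
  from assms have v: "v \<le> \<mu>" "v \<notin> A" "v \<notin> B'" "B' \<noteq> {}" "{v + 1..\<mu>} \<subseteq> insert u A"
    by (auto simp: matched_2_iff mem_X_iff)
  have "v \<le> Max B" using Max_simplex(2)[OF assms(3)] B by simp
  from assms(1,2) show False
  proof (cases rule: first_insertion_cases)
    case single
    with v B show False by auto
  next
    case last
    then obtain w where "Max B < w" "w < \<mu>" "w \<notin> A" by fastforce
    with \<open>v \<le> Max B\<close> have "w \<in> {v + 1..\<mu>}" by simp
    with v \<open>w \<notin> A\<close> have "w = u" by blast
    with \<open>w < \<mu>\<close> last show False by simp
  next
    case gap
    then have "u < \<mu>" "v \<noteq> \<mu>"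
      using Max_simplex(3)[OF assms(3)] B by auto
    with v have "\<mu> \<in> {v + 1..\<mu>}" by simp
    with v have "\<mu> \<in> insert u A" by blast
    with gap \<open>u < \<mu>\<close> show False by simp
  qed
qed

text \<open>The new second coordinate has at least two elements and maximum at least u, while A
  contains every vertex above u. This rules out the three alternatives in turn.\<close>

lemma not_first_insertion_insert_snd:
  assumes "\<kappa> + 2 \<le> \<mu>" "matched \<mu> \<kappa> 2 u (A, B)"
  shows "\<not> first_insertion \<mu> \<kappa> v A (insert u B)"
proof
  assume F: "first_insertion \<mu> \<kappa> v A (insert u B)"
  from assms have u: "u \<le> \<mu>" "u \<notin> B" "B \<noteq> {}" "{u + 1..\<mu>} \<subseteq> A"
    by (auto simp: matched_2_iff mem_X_iff)
  have "finite B" using matched_imp(1)[OF assms(2)] by (rule finite_simplices)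
  then have "u \<le> Max (insert u B)" by simp
  from assms(1) F show False
  proof (cases rule: first_insertion_cases)
    case single
    with u show False by auto
  next
    case last
    moreover have "{Max (insert u B) + 1..\<mu> - 1} \<subseteq> {u + 1..\<mu>}"
      using \<open>u \<le> Max (insert u B)\<close> by auto
    ultimately show False using u by blast
  next
    case gap
    then have "u \<noteq> \<mu>" by blast
    then have "\<mu> \<in> {u + 1..\<mu>}" using u by simp
    with u gap show False by blast
  qed
qed

text \<open>Different coordinates are excluded by \<open>no_mix\<close>; for equal coordinates the
  inserted vertex is determined. Together with \<open>matched_source_not_target\<close> this gives
  disjointness of the pairs.\<close>

lemma matched_unique:
  assumes "\<kappa> + 2 \<le> \<mu>" and u: "matched \<mu> \<kappa> r u \<alpha>" and v: "matched \<mu> \<kappa> s v \<beta>"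
    and eq: "\<alpha> = \<beta> \<or> add_vertex r u \<alpha> = add_vertex s v \<beta>"
  shows "r = s \<and> u = v"
proof -
  have no_mix: False
    if u: "matched \<mu> \<kappa> 1 u (A, B)" and v: "matched \<mu> \<kappa> 2 v (A', B')"
      and eq: "A = A' \<and> B = B' \<or> insert u A = A' \<and> B = insert v B'" for u v A B A' B'
  proof -
    have F: "first_insertion \<mu> \<kappa> u A B" "(A, B) \<in> X \<mu> \<kappa>"
      using u assms(1) by (auto simp: matched_1_iff)
    from eq show False
      using first_insertion_not_matched_2[OF assms(1) F(1) F(2) order_refl] v
        first_insertion_no_common_target[OF assms(1) F] by auto
  qed
  obtain A B where \<alpha>: "\<alpha> = (A, B)" by (cases \<alpha>)
  obtain A' B' where \<beta>: "\<beta> = (A', B')" by (cases \<beta>)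
  note cell = u[unfolded \<alpha>] v[unfolded \<beta>] eq[unfolded \<alpha> \<beta>]
  consider "r = 1" "s = 1" | "r = 1" "s = 2" | "r = 2" "s = 1" | "r = 2" "s = 2"
    using matched_imp(3)[OF u] matched_imp(3)[OF v] by blast
  then show ?thesis
  proof cases
    case 1
    then have "B = B'" and A: "A' = A \<or> insert u A = insert v A'"
      using cell(3) by (auto simp: add_vertex_def)
    moreover have "u \<notin> B" "v \<notin> B" "first_insertion \<mu> \<kappa> u A B" "first_insertion \<mu> \<kappa> v A' B"
      using cell(1,2) 1 assms(1) \<open>B = B'\<close> by (simp_all add: matched_1_iff)
    moreover have "Max B \<le> \<mu>"
      using Max_simplex(3) matched_imp(1)[OF cell(1)] .
    ultimately show ?thesis
      using first_insertion_unique[OF assms(1)] 1 by simp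
  next
    case 2
    then show ?thesis using no_mix[of u A B v A' B'] cell by (auto simp: add_vertex_def)
  next
    case 3
    then show ?thesis using no_mix[of v A' B' u A B] cell by (auto simp: add_vertex_def)
  next
    case 4
    then have "A = A'" using cell(3) by (auto simp: add_vertex_def)
    then show ?thesis
      using gap_unique[of u A \<mu> v] cell(1,2) 4 assms(1) by (simp add: matched_2_iff)
  qed
qed

lemma matched_source_not_target:
  assumes "\<kappa> + 2 \<le> \<mu>" and u: "matched \<mu> \<kappa> r u \<alpha>"
  shows "\<not> matched \<mu> \<kappa> s v (add_vertex r u \<alpha>)"
proof
  assume v: "matched \<mu> \<kappa> s v (add_vertex r u \<alpha>)"
  obtain A B where \<alpha>: "\<alpha> = (A, B)" by (cases \<alpha>)
  note u = u[unfolded \<alpha>] and v = v[unfolded \<alpha>]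
  have X: "(A, B) \<in> X \<mu> \<kappa>" "add_vertex r u (A, B) \<in> X \<mu> \<kappa>"
    using matched_imp[OF u] by simp_all
  consider "r = 1" "s = 1" | "r = 1" "s = 2" | "r = 2" "s = 1" | "r = 2" "s = 2"
    using matched_imp(3)[OF u] matched_imp(3)[OF v] by blast
  then show False
  proof cases
    case 1
    then show False
      using not_first_insertion_insert[OF assms(1) Max_simplex(3)[OF X(1)], of u A v] u v assms(1)
      by (auto simp: matched_1_iff add_vertex_def)
  next
    case 2
    then show False
      using first_insertion_not_matched_2[OF assms(1), of u A B "insert u A" v] u v X assms(1)
      by (auto simp: matched_1_iff add_vertex_def)
  next
    case 3
    then show False
      using not_first_insertion_insert_snd[OF assms(1), of u A B v] u v assms(1)
      by (auto simp: matched_1_iff add_vertex_def)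
  next
    case 4
    then show False
      using gap_unique[of u A \<mu> v] u v assms(1) by (auto simp: matched_2_iff add_vertex_def)
  qed
qed

section \<open>Every unmatched candidate meets an earlier edge\<close>

lemma largest_outside:
  fixes w :: nat
  assumes "w \<notin> S" "w \<le> m"
  obtains v where "w \<le> v" "v \<le> m" "v \<notin> S" "{v + 1..m} \<subseteq> S"
proof -
  define v where "v = Max ({w..m} - S)"
  have "v \<in> {w..m} - S"
    unfolding v_def using assms by (intro Max_in) auto
  have "x \<in> S" if "x \<in> {v + 1..m}" for x
  proof (rule ccontr)
    assume "x \<notin> S"
    with that \<open>v \<in> {w..m} - S\<close> have "x \<in> {w..m} - S" by simp
    then have "x \<le> v" unfolding v_def by (intro Max_ge) auto
    with that show False by simp
  qed
  then have "{v + 1..m} \<subseteq> S" by blast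
  with \<open>v \<in> {w..m} - S\<close> that show ?thesis by auto
qed

text \<open>Let v be the largest vertex outside A; it exceeds u because u is unmatched. If v is not
  in B, then (A, B) has its own edge at v. Otherwise exchanging v for u in B gives a lower cell
  whose edge has the same upper cell.\<close>

lemma unmatched_2_blocked:
  assumes "\<kappa> + 2 \<le> \<mu>" and AB: "(A, B) \<in> X \<mu> \<kappa>" and AuB: "(A, insert u B) \<in> X \<mu> \<kappa>"
    and u: "u \<notin> A" "u \<notin> B" "\<not> matched \<mu> \<kappa> 2 u (A, B)"
  obtains v where "u < v" "matched \<mu> \<kappa> 2 v (A, B)"
  | v B' where "u < v" "matched \<mu> \<kappa> 2 v (A, B')" "insert v B' = insert u B"
proof -
  note fin = finite_simplices[OF AB]
  have X: "A \<subseteq> {1..\<mu>}" "B \<subseteq> {1..\<mu>}" "A \<noteq> {}" "B \<noteq> {}" "card A \<le> \<mu> - \<kappa>" "card B < \<mu> - \<kappa>"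
    "A \<inter> B = {}" "1 \<le> u" "u \<le> \<mu>"
    using AB AuB u fin assms(1) by (auto simp: mem_X_iff)
  obtain v where v: "u \<le> v" "v \<le> \<mu>" "v \<notin> A" "{v + 1..\<mu>} \<subseteq> A"
    using largest_outside[OF u(1) X(9)] .
  with u X assms(1) AB have "v \<noteq> u" by (auto simp: matched_2_iff)
  with v have "u < v" by simp
  show ?thesis
  proof (cases "v \<in> B")
    case False
    with v X AB assms(1) have "matched \<mu> \<kappa> 2 v (A, B)" by (simp add: matched_2_iff)
    with \<open>u < v\<close> that(1) show ?thesis by blast
  next
    case True
    have "card (insert u B - {v}) = card B"
      using True fin u \<open>u < v\<close> by simp
    with v X u assms(1) True have "matched \<mu> \<kappa> 2 v (A, insert u B - {v})"
      using \<open>u < v\<close> by (auto simp: matched_2_iff mem_X_iff)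
    moreover have "insert v (insert u B - {v}) = insert u B" using True by auto
    ultimately show ?thesis using \<open>u < v\<close> that(2) by blast
  qed
qed

text \<open>Coordinate 2 is processed before coordinate 1, so the first two outcomes block whatever
  v is, while the last two need v above u. In each pair the blocking edge shares first the lower,
  then the upper cell.\<close>

lemma unmatched_1_blocked:
  assumes "\<kappa> + 2 \<le> \<mu>" and AB: "(A, B) \<in> X \<mu> \<kappa>" and AuB: "(insert u A, B) \<in> X \<mu> \<kappa>"
    and u: "u \<notin> A" "u \<notin> B" "\<not> matched \<mu> \<kappa> 1 u (A, B)"
  obtains v where "matched \<mu> \<kappa> 2 v (A, B)"
  | v B' where "matched \<mu> \<kappa> 2 v (insert u A, B')" "insert v B' = B"
  | v where "u < v" "matched \<mu> \<kappa> 1 v (A, B)"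
  | v A' where "u < v" "matched \<mu> \<kappa> 1 v (A', B)" "insert v A' = insert u A"
proof -
  note blocked = that
  note fin = finite_simplices[OF AB]
  have X: "A \<subseteq> {1..\<mu>}" "B \<subseteq> {1..\<mu>}" "A \<noteq> {}" "B \<noteq> {}" "card A < \<mu> - \<kappa>" "card B \<le> \<mu> - \<kappa>"
    "A \<inter> B = {}" "1 \<le> u" "u \<le> \<mu>"
    using AB AuB u fin assms(1) by (auto simp: mem_X_iff)
  note M = Max_simplex[OF AB]
  have no: "\<not> first_insertion \<mu> \<kappa> u A B"
    using u X AB assms(1) by (simp add: matched_1_iff)

  \<comment> \<open>Blocking through the upper cell: v is removed from B, which has to stay
    nonempty.\<close>
  have by_2: thesis
    if v: "v \<in> B" "{v + 1..\<mu>} \<subseteq> insert u A" and "B \<noteq> {v}" for v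
  proof -
    have "B - {v} \<noteq> {}" using \<open>B \<noteq> {v}\<close> v X(4) by blast
    moreover have "card (B - {v}) < \<mu> - \<kappa>"
      using card_Diff1_less[OF fin(2) v(1)] X(6) by simp
    moreover have "(insert u A, B - {v}) \<in> X \<mu> \<kappa>"
      using AuB calculation assms(1) by (auto simp: mem_X_iff)
    moreover have "v \<notin> insert u A" "1 \<le> v" "v \<le> \<mu>" using v X u by auto
    ultimately have "matched \<mu> \<kappa> 2 v (insert u A, B - {v})"
      using v assms(1) by (simp add: matched_2_iff)
    moreover have "insert v (B - {v}) = B" using v by auto
    ultimately show thesis by (rule blocked(2))
  qed

  \<comment> \<open>If v is not in A, the edge inserting v shares the lower cell; if it is,
    exchanging v for u in A gives an edge with the same upper cell.\<close>
  have by_1: thesis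
    if v: "u < v" "v \<le> \<mu>" "v \<notin> B"
      and "v \<notin> A \<Longrightarrow> first_insertion \<mu> \<kappa> v A B"
      and "v \<in> A \<Longrightarrow> first_insertion \<mu> \<kappa> v (insert u A - {v}) B" for v
  proof (cases "v \<in> A")
    case False
    with that(4) v X AB assms(1) have "matched \<mu> \<kappa> 1 v (A, B)" by (simp add: matched_1_iff)
    with v(1) show thesis by (rule blocked(3))
  next
    case True
    have "card (insert u A - {v}) = card A"
      using True fin u v by simp
    with that(5)[OF True] v X u assms(1) True have "matched \<mu> \<kappa> 1 v (insert u A - {v}, B)"
      by (auto simp: matched_1_iff mem_X_iff)
    moreover have "insert v (insert u A - {v}) = insert u A" using True by auto
    ultimately show thesis using v(1) by (intro blocked(4))
  qed

  show thesis
  proof (cases "card B < \<mu> - \<kappa>")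
    case True
    \<comment> \<open>An element of B shows that some vertex is outside A; the cases follow the
      largest such vertex v.\<close>
    obtain b where "b \<in> B" using X(4) by blast
    then have "b \<notin> A" "b \<le> \<mu>" using X by auto
    then obtain v where v: "b \<le> v" "v \<le> \<mu>" "v \<notin> A" "{v + 1..\<mu>} \<subseteq> A"
      by (rule largest_outside)
    show thesis
    proof (cases "v \<in> B")
      case False
      have "1 \<le> v" using v \<open>b \<in> B\<close> X by auto
      with False v True AB assms(1) have "matched \<mu> \<kappa> 2 v (A, B)" by (simp add: matched_2_iff)
      then show thesis by (rule blocked(1))
    next
      case vB: True
      show thesis
      proof (cases "B = {v}")
        case False
        with vB v show thesis by (intro by_2[of v]) auto
      next
        case B: True
        have "u < v"
        proof (rule ccontr)
          assume "\<not> u < v"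
          with u B have "v < u" by auto
          with X(9) have "u \<in> {v + 1..\<mu>}" by simp
          with v u show False by blast
        qed
        \<comment> \<open>Otherwise B = {u + 1} and the first alternative would match u. So v - 1
          exceeds u and its insertion blocks.\<close>
        moreover have "u \<noteq> v - 1"
          using no B v \<open>u < v\<close> by (auto simp: first_insertion_def)
        ultimately have "u < v - 1" "v - 1 + 1 = v" by auto
        moreover have "{v - 1 + 2..\<mu>} \<subseteq> S - {v - 1}" if "A \<subseteq> S" for S
          using v that \<open>u < v\<close> by auto
        ultimately show thesis
          using v B by (intro by_1[of "v - 1"]) (auto simp: first_insertion_def)
      qed
    qed
  next
    case False
    then have card: "card B = \<mu> - \<kappa>" using X by simp
    \<comment> \<open>A full B has at least two elements, so \<open>by_2\<close> can remove any one
      of them.\<close>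
    have ns: "B \<noteq> {b}" for b using card assms(1) by auto
    show thesis
    proof (cases "{Max B + 1..\<mu> - 1} \<subseteq> insert u A")
      case False
      then have "u \<noteq> \<mu>" using no card by (auto simp: first_insertion_def)
      \<comment> \<open>With \<mu> in B the interval above \<open>Max B\<close> would be empty,
        hence contained.\<close>
      have "\<mu> \<notin> B" using False M by (force dest: M(2))
      with False show thesis
        using X card \<open>u \<noteq> \<mu>\<close> by (intro by_1[of \<mu>]) (auto simp: first_insertion_def)
    next
      case sub: True
      show thesis
      proof (cases "Max B = \<mu> \<or> \<mu> \<in> insert u A")
        case True
        \<comment> \<open>So the upper cell already arises by inserting \<open>Max B\<close> into
          the second coordinate.\<close>
        have "{Max B + 1..\<mu>} \<subseteq> insert u A"
        proof
          fix x assume "x \<in> {Max B + 1..\<mu>}"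
          then have "x = \<mu> \<or> x \<in> {Max B + 1..\<mu> - 1}" by auto
          with True sub \<open>x \<in> {Max B + 1..\<mu>}\<close> show "x \<in> insert u A" by auto
        qed
        then show thesis using M(1) ns by (intro by_2[of "Max B"]) auto
      next
        case \<mu>: False
        then have "Max B < \<mu>" "\<mu> \<notin> B" "\<mu> \<notin> A" "u < \<mu>"
          using M X(9) by (auto simp: le_less dest: M(2))
        show thesis
        proof (cases "Max B < u")
          case True
          with \<open>u < \<mu>\<close> have "u \<in> {Max B + 1..\<mu> - 1}" by auto
          \<comment> \<open>The missing vertex is u itself, so inserting \<mu> into A is an earlier
            step.\<close>
          with u have "\<not> {Max B + 1..\<mu> - 1} \<subseteq> A" by blast
          with card \<open>\<mu> \<notin> A\<close> \<open>\<mu> \<notin> B\<close> \<open>u < \<mu>\<close> show thesis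
            by (intro by_1[of \<mu>]) (auto simp: first_insertion_def)
        next
          case False
          then have "u \<le> Max B" by simp
          \<comment> \<open>For v = u the third alternative would match u, so v is larger than u and
            its insertion comes earlier.\<close>
          with u(2) obtain v where v: "u \<le> v" "v \<le> Max B" "v \<notin> B" "{v + 1..Max B} \<subseteq> B"
            by (rule largest_outside)
          have "v < Max B" using v M(1) by (metis le_neq_implies_less)
          have subA: "{Max B + 1..\<mu> - 1} \<subseteq> A" using sub \<open>u \<le> Max B\<close> by auto
          \<comment> \<open>Applied to A and to \<open>insert u A - {v}\<close>, the two lower cells
            that \<open>by_1\<close> may need.\<close>
          have F: "first_insertion \<mu> \<kappa> v S B"
            if "\<mu> \<notin> S" "{Max B + 1..\<mu> - 1} \<subseteq> S" for S
            using that card \<open>\<mu> \<notin> B\<close> \<open>v < Max B\<close> v by (simp add: first_insertion_def)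
          have "v \<noteq> u" using F[of A] subA \<open>\<mu> \<notin> A\<close> no by auto
          with v have "u < v" by simp
          moreover have "{Max B + 1..\<mu> - 1} \<subseteq> insert u A - {v}"
            using subA \<open>v < Max B\<close> by auto
          ultimately show thesis
            using v \<open>\<mu> \<notin> A\<close> \<open>u < \<mu>\<close> \<open>Max B < \<mu>\<close> subA by (intro by_1[of v] F) auto
        qed
      qed
    qed
  qed
qed

text \<open>The condition on s and v is the processing order within one dimension: coordinate 2
  first, then larger vertices first.\<close>

lemma unmatched_blocked:
  assumes "\<kappa> + 2 \<le> \<mu>" "\<alpha> \<in> X \<mu> \<kappa>" "add_vertex_defined \<mu> \<kappa> r u \<alpha>" "r = 1 \<or> r = 2"
    and "\<not> matched \<mu> \<kappa> r u \<alpha>"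
  obtains s v \<beta> where "matched \<mu> \<kappa> s v \<beta>" "r < s \<or> s = r \<and> u < v"
    "\<beta> = \<alpha> \<or> add_vertex s v \<beta> = add_vertex r u \<alpha>"
proof -
  obtain A B where \<alpha>: "\<alpha> = (A, B)" by (cases \<alpha>)
  have u: "u \<notin> A" "u \<notin> B" using assms(3) by (simp_all add: \<alpha> add_vertex_defined_def)
  have AB: "(A, B) \<in> X \<mu> \<kappa>" using assms(2) \<alpha> by simp
  from assms(4) show ?thesis
  proof
    assume r: "r = 1"
    then have *: "(insert u A, B) \<in> X \<mu> \<kappa>" "\<not> matched \<mu> \<kappa> 1 u (A, B)"
      using assms(3,5) by (simp_all add: \<alpha> add_vertex_defined_def add_vertex_def)
    from assms(1) AB *(1) u *(2) show ?thesis
    proof (cases rule: unmatched_1_blocked)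
      case (1 v)
      then show ?thesis using r \<alpha> by (intro that[of 2 v "(A, B)"]) auto
    next
      case (2 v B')
      then show ?thesis using r \<alpha> by (intro that[of 2 v "(insert u A, B')"]) (auto simp: add_vertex_def)
    next
      case (3 v)
      then show ?thesis using r \<alpha> by (intro that[of 1 v "(A, B)"]) auto
    next
      case (4 v A')
      then show ?thesis using r \<alpha> by (intro that[of 1 v "(A', B)"]) (auto simp: add_vertex_def)
    qed
  next
    assume r: "r = 2"
    then have *: "(A, insert u B) \<in> X \<mu> \<kappa>" "\<not> matched \<mu> \<kappa> 2 u (A, B)"
      using assms(3,5) by (simp_all add: \<alpha> add_vertex_defined_def add_vertex_def)
    from assms(1) AB *(1) u *(2) show ?thesis
    proof (cases rule: unmatched_2_blocked)
      case (1 v)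
      then show ?thesis using r \<alpha> by (intro that[of 2 v "(A, B)"]) auto
    next
      case (2 v B')
      then show ?thesis using r \<alpha> by (intro that[of 2 v "(A, B')"]) (auto simp: add_vertex_def)
    qed
  qed
qed

section \<open>Running the construction\<close>

text \<open>The run visits triples in decreasing lexicographic order. The second triple is the one
  visited first, so \<open>earlier p r u\<close> is the set of steps done before (p, r, u).\<close>

definition earlier :: "nat \<Rightarrow> nat \<Rightarrow> nat \<Rightarrow> nat \<Rightarrow> nat \<Rightarrow> nat \<Rightarrow> bool" where
  "earlier p r u p' r' u' \<longleftrightarrow> p < p' \<or> p' = p \<and> (r < r' \<or> r' = r \<and> u < u')"

lemma untouchedD:
  assumes "untouched \<mu> \<kappa> P \<gamma>" "matched \<mu> \<kappa> r u \<alpha>" "P (cell_dim \<alpha>) r u"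
  shows "\<alpha> \<noteq> \<gamma>" "add_vertex r u \<alpha> \<noteq> \<gamma>"
proof -
  have "(\<alpha>, add_vertex r u \<alpha>) \<in> edges_where \<mu> \<kappa> P"
    unfolding edges_where_def using assms(2,3) by blast
  with assms(1) show "\<alpha> \<noteq> \<gamma>" "add_vertex r u \<alpha> \<noteq> \<gamma>"
    by (force simp: untouched_def)+
qed

lemma untouchedI:
  assumes "\<And>r u \<alpha>. matched \<mu> \<kappa> r u \<alpha> \<Longrightarrow> P (cell_dim \<alpha>) r u \<Longrightarrow> \<alpha> \<noteq> \<gamma> \<and> add_vertex r u \<alpha> \<noteq> \<gamma>"
  shows "untouched \<mu> \<kappa> P \<gamma>"
  using assms by (fastforce simp: untouched_def edges_where_def)

text \<open>Disjointness gives one direction, blocking the other; this supplies the hypothesis of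
  \<open>process_vertex_state_of\<close>.\<close>

lemma matched_iff_untouched:
  assumes "\<kappa> + 2 \<le> \<mu>" "\<alpha> \<in> X \<mu> \<kappa>" "add_vertex_defined \<mu> \<kappa> r u \<alpha>" "r = 1 \<or> r = 2"
  defines "P \<equiv> earlier (cell_dim \<alpha>) r u"
  shows "matched \<mu> \<kappa> r u \<alpha> \<longleftrightarrow> untouched \<mu> \<kappa> P \<alpha> \<and> untouched \<mu> \<kappa> P (add_vertex r u \<alpha>)"
proof
  assume M: "matched \<mu> \<kappa> r u \<alpha>"
  have "\<beta> \<noteq> \<alpha> \<and> add_vertex s v \<beta> \<noteq> \<alpha> \<and> \<beta> \<noteq> add_vertex r u \<alpha> \<and> add_vertex s v \<beta> \<noteq> add_vertex r u \<alpha>"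
    if M': "matched \<mu> \<kappa> s v \<beta>" and P: "P (cell_dim \<beta>) s v" for s v \<beta>
  proof -
    have "\<beta> \<noteq> \<alpha> \<and> add_vertex s v \<beta> \<noteq> add_vertex r u \<alpha>"
    proof (rule ccontr)
      assume *: "\<not> ?thesis"
      \<comment> \<open>Pairs sharing a lower or an upper cell belong to one step and hence
        coincide, but no step precedes itself.\<close>
      then have "r = s" "u = v" using matched_unique[OF assms(1) M M'] by auto
      moreover from this * have "\<beta> = \<alpha>"
        using add_vertex_cancel[OF matched_imp(2)[OF M'], of \<alpha>] matched_imp(2)[OF M] by auto
      ultimately show False using P by (simp add: P_def earlier_def)
    qed
    moreover have "add_vertex s v \<beta> \<noteq> \<alpha>" "\<beta> \<noteq> add_vertex r u \<alpha>"
      using matched_source_not_target[OF assms(1) M] matched_source_not_target[OF assms(1) M'] M M'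
      by auto
    ultimately show ?thesis by simp
  qed
  then show "untouched \<mu> \<kappa> P \<alpha> \<and> untouched \<mu> \<kappa> P (add_vertex r u \<alpha>)"
    by (blast intro: untouchedI)
next
  assume U: "untouched \<mu> \<kappa> P \<alpha> \<and> untouched \<mu> \<kappa> P (add_vertex r u \<alpha>)"
  show "matched \<mu> \<kappa> r u \<alpha>"
  proof (rule ccontr)
    assume "\<not> matched \<mu> \<kappa> r u \<alpha>"
    then obtain s v \<beta> where M: "matched \<mu> \<kappa> s v \<beta>" and less: "r < s \<or> s = r \<and> u < v"
      and eq: "\<beta> = \<alpha> \<or> add_vertex s v \<beta> = add_vertex r u \<alpha>"
      using unmatched_blocked[OF assms(1-4)] by blast
    \<comment> \<open>A shared lower or upper cell fixes the dimension, so the blocking edge belongs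
      to the same p.\<close>
    from eq have "cell_dim \<beta> = cell_dim \<alpha>"
      using cell_dim_add_vertex[OF assms(2,3)] cell_dim_add_vertex[OF matched_imp(1,2)[OF M]]
      by auto
    with less have "P (cell_dim \<beta>) s v" by (auto simp: P_def earlier_def)
    with U M eq show False using untouchedD by blast
  qed
qed

text \<open>Only triples realised by matched pairs count, so different descriptions of one moment of
  the run can be exchanged.\<close>

lemma state_of_cong:
  assumes "\<And>r u \<alpha>. matched \<mu> \<kappa> r u \<alpha> \<Longrightarrow> P (cell_dim \<alpha>) r u \<longleftrightarrow> Q (cell_dim \<alpha>) r u"
  shows "state_of \<mu> \<kappa> P = state_of \<mu> \<kappa> Q"
proof -
  have "edges_where \<mu> \<kappa> P = edges_where \<mu> \<kappa> Q"
    unfolding edges_where_def using assms by blast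
  then show ?thesis by (simp add: state_of_def untouched_def)
qed

lemma process_vertex_earlier:
  assumes "\<kappa> + 2 \<le> \<mu>" "r = 1 \<or> r = 2"
  shows "process_vertex \<mu> \<kappa> p r (Suc u) (state_of \<mu> \<kappa> (earlier p r (Suc u))) =
    state_of \<mu> \<kappa> (earlier p r u)"
proof -
  have "process_vertex \<mu> \<kappa> p r (Suc u) (state_of \<mu> \<kappa> (earlier p r (Suc u))) =
    state_of \<mu> \<kappa> (\<lambda>p' r' u'. earlier p r (Suc u) p' r' u' \<or> p' = p \<and> r' = r \<and> u' = Suc u)"
    using matched_iff_untouched assms by (intro process_vertex_state_of) blast
  also have "\<dots> = state_of \<mu> \<kappa> (earlier p r u)"
    by (rule state_of_cong) (auto simp: earlier_def)
  finally show ?thesis .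
qed

text \<open>As 0 is no vertex, \<open>earlier p r 0\<close> describes coordinate r as
  finished.\<close>

lemma fold_process_vertex:
  assumes "\<kappa> + 2 \<le> \<mu>" "r = 1 \<or> r = 2"
  shows "fold (process_vertex \<mu> \<kappa> p r) (rev [1..<u + 1]) (state_of \<mu> \<kappa> (earlier p r u)) =
    state_of \<mu> \<kappa> (earlier p r 0)"
proof (induction u)
  case 0
  then show ?case by simp
next
  case (Suc u)
  then show ?case using process_vertex_earlier[OF assms] by simp
qed

lemma process_coordinates:
  assumes "\<kappa> + 2 \<le> \<mu>"
  shows "fold (process_coordinate \<mu> \<kappa> p) [2, 1] (state_of \<mu> \<kappa> (earlier p 2 \<mu>)) =
    state_of \<mu> \<kappa> (earlier p 1 0)"
proof -
  \<comment> \<open>Coordinates are 1 or 2 and vertices lie in 1..\<mu>, so finishing coordinate 2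
    and not having started coordinate 1 are the same moment.\<close>
  have "state_of \<mu> \<kappa> (earlier p 2 0) = state_of \<mu> \<kappa> (earlier p 1 \<mu>)"
    by (rule state_of_cong) (auto simp: earlier_def dest: matched_imp(3-5))
  then show ?thesis
    using fold_process_vertex[OF assms, of _ p \<mu>] by (simp add: process_coordinate_def)
qed

lemma fold_idle: "(\<And>x. f x y = y) \<Longrightarrow> fold f xs y = y"
  by (induction xs) simp_all

text \<open>Because of this the nonemptiness condition in \<open>process_dim\<close> is redundant.\<close>

lemma process_coordinate_idle:
  assumes "snd st p = {} \<or> snd st (p + 1) = {}"
  shows "process_coordinate \<mu> \<kappa> p r st = st"
proof -
  have "process_cell \<mu> \<kappa> p r u \<alpha> st = st" for u \<alpha>
    using assms by (auto simp: process_cell_def Let_def)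
  then have "process_vertex \<mu> \<kappa> p r u st = st" for u
    unfolding process_vertex_def by (rule fold_idle)
  then show ?thesis
    unfolding process_coordinate_def by (rule fold_idle)
qed

lemma process_dim_state_of:
  assumes "\<kappa> + 2 \<le> \<mu>"
  shows "process_dim \<mu> \<kappa> p (state_of \<mu> \<kappa> (\<lambda>p' _ _. Suc p \<le> p')) = state_of \<mu> \<kappa> (\<lambda>p' _ _. p \<le> p')"
proof -
  have "process_dim \<mu> \<kappa> p st = fold (process_coordinate \<mu> \<kappa> p) [2, 1] st" for st
    by (simp add: process_dim_def process_coordinate_idle)
  moreover have "state_of \<mu> \<kappa> (\<lambda>p' _ _. Suc p \<le> p') = state_of \<mu> \<kappa> (earlier p 2 \<mu>)"
    by (rule state_of_cong) (auto simp: earlier_def dest: matched_imp(3-5))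
  moreover have "state_of \<mu> \<kappa> (earlier p 1 0) = state_of \<mu> \<kappa> (\<lambda>p' _ _. p \<le> p')"
    by (rule state_of_cong) (auto simp: earlier_def dest: matched_imp(3-5))
  ultimately show ?thesis using process_coordinates[OF assms] by simp
qed

lemma fold_process_dim:
  assumes "\<kappa> + 2 \<le> \<mu>"
  shows "fold (process_dim \<mu> \<kappa>) (rev [0..<n]) (state_of \<mu> \<kappa> (\<lambda>p _ _. n \<le> p)) =
    state_of \<mu> \<kappa> (\<lambda>p _ _. 0 \<le> p)"
proof (induction n)
  case 0
  then show ?case by simp
next
  case (Suc n)
  then show ?case using process_dim_state_of[OF assms] by simp
qed

lemma W_eq_matched:
  assumes "\<kappa> + 2 \<le> \<mu>"
  shows "W \<mu> \<kappa> = {(\<alpha>, add_vertex r u \<alpha>) | \<alpha> r u. matched \<mu> \<kappa> r u \<alpha>}"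
proof -
  \<comment> \<open>The upper cell has dimension at most \<open>dim_X\<close>, so the run starts
    with an empty edge set and misses no matched pair.\<close>
  have "\<not> dim_X \<mu> \<kappa> \<le> cell_dim \<alpha>" if "matched \<mu> \<kappa> r u \<alpha>" for r u \<alpha>
  proof -
    have "cell_dim (add_vertex r u \<alpha>) \<le> dim_X \<mu> \<kappa>"
      using matched_imp(6)[OF that] finite_X by (simp add: dim_X_def)
    then show ?thesis
      using cell_dim_add_vertex[OF matched_imp(1,2)[OF that]] by simp
  qed
  then have none: "edges_where \<mu> \<kappa> (\<lambda>p _ _. dim_X \<mu> \<kappa> \<le> p) = {}"
    by (auto simp: edges_where_def)
  have "initial_state \<mu> \<kappa> = state_of \<mu> \<kappa> (\<lambda>p _ _. dim_X \<mu> \<kappa> \<le> p)"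
    unfolding initial_state_def state_of_def untouched_def none by simp
  then show ?thesis
    unfolding W_def by (simp add: fold_process_dim[OF assms]) (simp add: state_of_def edges_where_def)
qed

section \<open>Edges in the first coordinate\<close>

text \<open>Passes from the upper cell to the lower one, which is a cell because A has at least two
  elements.\<close>

lemma edge_delete_first:
  assumes "\<kappa> + 2 \<le> \<mu>" "(A, B) \<in> X \<mu> \<kappa>" "card A > 1" "x \<in> A" "first_insertion \<mu> \<kappa> x (A - {x}) B"
  shows "((A - {x}, B), (A, B)) \<in> W \<mu> \<kappa>"
proof -
  note fin = finite_simplices[OF assms(2)]
  have card: "card (A - {x}) = card A - 1" using fin assms(4) by simp
  then have "A - {x} \<noteq> {}" using assms(3) by fastforce
  then have "matched \<mu> \<kappa> 1 x (A - {x}, B)"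
    using assms card by (auto simp: matched_1_iff mem_X_iff)
  moreover have "add_vertex 1 x (A - {x}, B) = (A, B)"
    using assms(4) by (auto simp: add_vertex_def)
  ultimately show ?thesis unfolding W_eq_matched[OF assms(1)] by force
qed

text \<open>An insertion in the second coordinate would change B, so the edge comes from coordinate
  1, and the new vertex can only be u.\<close>

lemma edge_insert_first:
  assumes "\<kappa> + 2 \<le> \<mu>" "((A, B), (insert u A, B)) \<in> W \<mu> \<kappa>"
  shows "matched \<mu> \<kappa> 1 u (A, B)"
proof -
  obtain r v where M: "matched \<mu> \<kappa> r v (A, B)" and eq: "(insert u A, B) = add_vertex r v (A, B)"
    using assms(2) unfolding W_eq_matched[OF assms(1)] by auto
  have "v \<notin> A" "v \<notin> B" using matched_imp(2)[OF M] by (auto simp: add_vertex_defined_def)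
  with eq have "r = 1" "v = u"
    using matched_imp(3)[OF M] by (auto simp: add_vertex_def)
  with M show ?thesis by simp
qed

text \<open>Translates between the maximum in (2.b) and the gap form in
  \<open>first_insertion\<close>. Nonemptiness is kept because \<open>Max\<close> of the empty set
  is unspecified.\<close>

lemma Max_outside_iff:
  fixes m :: nat
  assumes "m \<in> B"
  shows "({1..m - 1} - B \<noteq> {} \<and> Max ({1..m - 1} - B) = u) \<longleftrightarrow>
    1 \<le> u \<and> u < m \<and> u \<notin> B \<and> {u + 1..m} \<subseteq> B"
proof (intro iffI conjI)
  assume *: "{1..m - 1} - B \<noteq> {} \<and> Max ({1..m - 1} - B) = u"
  then have "u \<in> {1..m - 1} - B" using Max_in[of "{1..m - 1} - B"] by auto
  then show "1 \<le> u" "u < m" "u \<notin> B" by auto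
  show "{u + 1..m} \<subseteq> B"
  proof (rule ccontr)
    assume "\<not> ?thesis"
    then obtain x where x: "x \<in> {u + 1..m}" "x \<notin> B" by blast
    with assms have "x \<noteq> m" by blast
    with x have "x \<in> {1..m - 1} - B" by auto
    then have "x \<le> u" using * Max_ge[of "{1..m - 1} - B" x] by simp
    with x show False by simp
  qed
next
  assume *: "1 \<le> u \<and> u < m \<and> u \<notin> B \<and> {u + 1..m} \<subseteq> B"
  then have u: "u \<in> {1..m - 1} - B" by auto
  then show "{1..m - 1} - B \<noteq> {}" by blast
  show "Max ({1..m - 1} - B) = u"
  proof (rule Max_eqI)
    fix x assume x: "x \<in> {1..m - 1} - B"
    show "x \<le> u"
    proof (rule ccontr)
      assume "\<not> x \<le> u"
      with x have "x \<in> {u + 1..m}" by auto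
      with * x show False by blast
    qed
  qed (use u in auto)
qed

theorem theorem4p3:
  fixes \<mu> \<kappa> :: nat
  assumes "2 \<le> \<kappa>" and "\<kappa> + 2 \<le> \<mu>"
  shows
    "(\<forall>A B. (A, B) \<in> X \<mu> \<kappa> \<and> card A > 1 \<longrightarrow>
        ({Max B + 1..\<mu>} \<subseteq> A \<and> card B = 1 \<longrightarrow>
           (Min B - 1 \<in> A \<longrightarrow> ((A - {Min B - 1}, B), (A, B)) \<in> W \<mu> \<kappa>)) \<and>
        (\<not> {Max B + 1..\<mu>} \<subseteq> A \<and> card B = \<mu> - \<kappa> \<longrightarrow>
           (Max A = \<mu> \<longrightarrow> ((A - {\<mu>}, B), (A, B)) \<in> W \<mu> \<kappa>) \<and>
           (Max A < \<mu> \<and> {Max B + 1..\<mu> - 1} \<subseteq> A \<and> \<not> {1..Max B - 1} \<subseteq> B \<and>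
              Max ({1..Max B - 1} - B) \<in> A \<longrightarrow>
              ((A - {Max ({1..Max B - 1} - B)}, B), (A, B)) \<in> W \<mu> \<kappa>))) \<and>
     (\<forall>A' B u. ((A', B), (insert u A', B)) \<in> W \<mu> \<kappa> \<longrightarrow>
        (\<exists>A. A = insert u A' \<and> (A, B) \<in> X \<mu> \<kappa> \<and> card A > 1 \<and>
           (({Max B + 1..\<mu>} \<subseteq> A \<and> card B = 1 \<and> Min B - 1 \<in> A \<and> A' = A - {Min B - 1}) \<or>
            (\<not> {Max B + 1..\<mu>} \<subseteq> A \<and> card B = \<mu> - \<kappa> \<and> Max A = \<mu> \<and> A' = A - {\<mu>}) \<or>
            (\<not> {Max B + 1..\<mu>} \<subseteq> A \<and> card B = \<mu> - \<kappa> \<and> Max A < \<mu> \<and>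
               {Max B + 1..\<mu> - 1} \<subseteq> A \<and> \<not> {1..Max B - 1} \<subseteq> B \<and>
               Max ({1..Max B - 1} - B) \<in> A \<and> A' = A - {Max ({1..Max B - 1} - B)}))))"
proof (intro conjI allI impI)
  fix A B
  assume "(A, B) \<in> X \<mu> \<kappa> \<and> 1 < card A"
  then have AB: "(A, B) \<in> X \<mu> \<kappa>" and "1 < card A" by simp_all
  note edge = edge_delete_first[OF assms(2) AB \<open>1 < card A\<close>]
  note M = Max_simplex[OF AB]
  have X: "A \<subseteq> {1..\<mu>}" "A \<noteq> {}" "A \<inter> B = {}" and "finite A"
    using AB assms finite_simplices[OF AB] by (auto simp: mem_X_iff)
  {
    assume *: "{Max B + 1..\<mu>} \<subseteq> A \<and> card B = 1" and mem: "Min B - 1 \<in> A"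
    then obtain b where B: "B = {b}" by (auto simp: card_1_singleton_iff)
    \<comment> \<open>Vertices are positive, so b is at least 2 and the truncated b - 1 is a genuine
      predecessor.\<close>
    have "1 \<le> b - 1" using mem X B by auto
    with * B have "first_insertion \<mu> \<kappa> (b - 1) (A - {b - 1}) B"
      by (auto simp: first_insertion_def)
    with mem B show "((A - {Min B - 1}, B), (A, B)) \<in> W \<mu> \<kappa>"
      using edge[of "b - 1"] by simp
  next
    assume *: "\<not> {Max B + 1..\<mu>} \<subseteq> A \<and> card B = \<mu> - \<kappa>" and Max: "Max A = \<mu>"
    then have "\<mu> \<in> A" using Max_in[OF \<open>finite A\<close> X(2)] by simp
    \<comment> \<open>As \<mu> lies in A, the missing vertex is strictly below \<mu>, as the second
      alternative demands.\<close>
    obtain x where x: "x \<in> {Max B + 1..\<mu>}" "x \<notin> A" using * by blast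
    with \<open>\<mu> \<in> A\<close> have "x \<noteq> \<mu>" by blast
    with x have "x \<in> {Max B + 1..\<mu> - 1}" by auto
    with x * have "first_insertion \<mu> \<kappa> \<mu> (A - {\<mu>}) B"
      unfolding first_insertion_def by blast
    with \<open>\<mu> \<in> A\<close> show "((A - {\<mu>}, B), (A, B)) \<in> W \<mu> \<kappa>" by (rule edge)
  next
    let ?a = "Max ({1..Max B - 1} - B)"
    assume *: "\<not> {Max B + 1..\<mu>} \<subseteq> A \<and> card B = \<mu> - \<kappa>"
      and **: "Max A < \<mu> \<and> {Max B + 1..\<mu> - 1} \<subseteq> A \<and> \<not> {1..Max B - 1} \<subseteq> B \<and> ?a \<in> A"
    have a: "?a < Max B" "{?a + 1..Max B} \<subseteq> B"
      using Max_outside_iff[OF M(1), of ?a] ** by auto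
    have "\<mu> \<notin> A" using ** \<open>finite A\<close> by (meson Max_ge leD)
    moreover have "\<mu> \<notin> B" using * M(2)[of \<mu>] by auto
    \<comment> \<open>The deleted vertex lies below \<open>Max B\<close>, so the interval above
      \<open>Max B\<close> survives the deletion.\<close>
    moreover have "?a \<notin> {Max B + 1..\<mu> - 1}" using a(1) by (meson atLeastAtMost_iff add_leD1 leD)
    then have "{Max B + 1..\<mu> - 1} \<subseteq> A - {?a}" using ** by blast
    ultimately have "first_insertion \<mu> \<kappa> ?a (A - {?a}) B"
      using * a by (auto simp: first_insertion_def)
    with ** show "((A - {?a}, B), (A, B)) \<in> W \<mu> \<kappa>" using edge by blast
  }
next
  fix A' B u
  assume "((A', B), (insert u A', B)) \<in> W \<mu> \<kappa>"
  then have M: "matched \<mu> \<kappa> 1 u (A', B)" by (rule edge_insert_first[OF assms(2)])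
  then have AB: "(A', B) \<in> X \<mu> \<kappa>" and u: "1 \<le> u" "u \<notin> A'" "u \<notin> B"
    and F: "first_insertion \<mu> \<kappa> u A' B"
    using assms by (auto simp: matched_1_iff)
  have A: "(insert u A', B) \<in> X \<mu> \<kappa>"
    using matched_imp(6)[OF M] by (simp add: add_vertex_def)
  have X: "A' \<subseteq> {1..\<mu>}" "A' \<noteq> {}" "finite A'"
    using AB assms finite_simplices[OF AB] by (auto simp: mem_X_iff)
  have card: "card (insert u A') > 1"
    using X u by (simp add: card_gt_0_iff)
  have A': "A' = insert u A' - {u}" using u by simp
  note MB = Max_simplex[OF AB]
  \<comment> \<open>The three types are first expressed through the inserted vertex u;
    \<open>A' = insert u A' - {u}\<close> then gives the form with a deleted vertex.\<close>
  from assms(2) F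
  have "({Max B + 1..\<mu>} \<subseteq> insert u A' \<and> card B = 1 \<and> Min B - 1 = u) \<or>
    (\<not> {Max B + 1..\<mu>} \<subseteq> insert u A' \<and> card B = \<mu> - \<kappa> \<and> Max (insert u A') = \<mu> \<and> u = \<mu>) \<or>
    (\<not> {Max B + 1..\<mu>} \<subseteq> insert u A' \<and> card B = \<mu> - \<kappa> \<and> Max (insert u A') < \<mu> \<and>
      {Max B + 1..\<mu> - 1} \<subseteq> insert u A' \<and> \<not> {1..Max B - 1} \<subseteq> B \<and> Max ({1..Max B - 1} - B) = u)"
  proof (cases rule: first_insertion_cases)
    case single
    then show ?thesis by auto
  next
    case last
    obtain x where x: "x \<in> {Max B + 1..\<mu> - 1}" "x \<notin> A'" using last by blast
    then have "x \<in> {Max B + 1..\<mu>}" "x \<noteq> u" using last(2) by auto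
    with x have "\<not> {Max B + 1..\<mu>} \<subseteq> insert u A'" by blast
    moreover have "Max (insert u A') = \<mu>"
      using X last(2) by (intro Max_eqI) auto
    ultimately show ?thesis using last by blast
  next
    case gap
    have "Max B \<noteq> \<mu>" using gap(3) MB(1) by metis
    with MB(3) gap have "Max B < \<mu>" "u < \<mu>" by auto
    then have "\<mu> \<in> {Max B + 1..\<mu>}" "\<mu> \<notin> insert u A'" using gap by auto
    then have "\<not> {Max B + 1..\<mu>} \<subseteq> insert u A'" by blast
    moreover have "x < \<mu>" if "x \<in> insert u A'" for x
      using that X(1) \<open>\<mu> \<notin> insert u A'\<close> \<open>u < \<mu>\<close> by (cases "x = \<mu>") auto
    then have "Max (insert u A') < \<mu>" using X by simp
    moreover have "\<not> {1..Max B - 1} \<subseteq> B" "Max ({1..Max B - 1} - B) = u"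
      using Max_outside_iff[OF MB(1), of u] gap u by auto
    ultimately show ?thesis using gap by blast
  qed
  then show "\<exists>A. A = insert u A' \<and> (A, B) \<in> X \<mu> \<kappa> \<and> card A > 1 \<and>
           (({Max B + 1..\<mu>} \<subseteq> A \<and> card B = 1 \<and> Min B - 1 \<in> A \<and> A' = A - {Min B - 1}) \<or>
            (\<not> {Max B + 1..\<mu>} \<subseteq> A \<and> card B = \<mu> - \<kappa> \<and> Max A = \<mu> \<and> A' = A - {\<mu>}) \<or>
            (\<not> {Max B + 1..\<mu>} \<subseteq> A \<and> card B = \<mu> - \<kappa> \<and> Max A < \<mu> \<and>
               {Max B + 1..\<mu> - 1} \<subseteq> A \<and> \<not> {1..Max B - 1} \<subseteq> B \<and>
               Max ({1..Max B - 1} - B) \<in> A \<and> A' = A - {Max ({1..Max B - 1} - B)}))"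
    using A card A' by (intro exI[of _ "insert u A'"]) (elim disjE conjE; simp)
qed

end
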